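(* Let $Q=(q_{ij})$ be a real symmetric $n\times n$ matrix with zero diagonal, $c\in\mathbb{R}^n$, $R_i=\{j:q_{ij}\neq0\}$, and let $\alpha_{ij}>0$ for $j\in R_i$, $i=1,\dots,n$. Consider the MILP GW($\alpha$) in variables $x_i$ and $y_{ij}$ ($j\in R_i$): maximize $\sum_{i=1}^n\sum_{j\in R_i}q_{ij}y_{ij}+\sum_{i=1}^n c_ix_i$ subject to $\sum_{j\in R_i}\alpha_{ij}(x_j-y_{ij})\le\left(\sum_{j\in R_i}\alpha_{ij}\right)(1-x_i)$ for $i=1,\dots,n$; $y_{ij}-x_i\le 0$ for all $j\in R_i$, $i=1,\dots,n$; $y_{ji}-x_i\le 0$ for all $j\in R_i$, $i=1,\dots,n$; $x_i\in\{0,1\}$ for all $i$; $y_{ij}\ge 0$ for all $j\in R_i$, $i=1,\dots,n$. Then GW($\alpha$) is a valid formulation of QUBO.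
   Context: QUBO is the problem: maximize $\sum_{i=1}^n\sum_{j\in R_i}q_{ij}x_ix_j+\sum_{i=1}^n c_ix_i$ over $x\in\{0,1\}^n$. An MILP in variables $(x,y)$ with objective $\sum_i\sum_{j\in R_i}q_{ij}y_{ij}+\sum_i c_ix_i$ is a valid formulation of QUBO if its optimal objective value equals the optimal value of QUBO and the $x$-part of every optimal solution of the MILP is an optimal solution of QUBO. *)

theory Defs
  imports "HOL-Analysis.Analysis"
begin

definition nbrs :: "real ^ 'n ^ 'n \<Rightarrow> 'n \<Rightarrow> 'n::finite set" where
  "nbrs Q i = {j. Q $ i $ j \<noteq> 0}"

(* The value relation also asserts that the maximum over F is attained. *)
definition has_optimal_value :: "'a set \<Rightarrow> ('a \<Rightarrow> real) \<Rightarrow> real \<Rightarrow> bool" where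
  "has_optimal_value F f v \<longleftrightarrow> (\<exists>z. is_arg_max f (\<lambda>z. z \<in> F) z \<and> f z = v)"

definition qubo_feasible :: "(real ^ 'n::finite) set" where
  "qubo_feasible = {x. \<forall>i. x $ i \<in> {0, 1}}"

definition qubo_objective ::
    "real ^ 'n ^ 'n \<Rightarrow> real ^ 'n \<Rightarrow> real ^ 'n::finite \<Rightarrow> real" where
  "qubo_objective Q c x =
     (\<Sum>i\<in>UNIV. \<Sum>j\<in>nbrs Q i. Q $ i $ j * x $ i * x $ j) + (\<Sum>i\<in>UNIV. c $ i * x $ i)"

(* The variable y_ij exists only for j in nbrs Q i. A vector y is a function on pairs that is
   extensional on this index set, so that y (i, j) carries no information elsewhere. *)
definition y_index :: "real ^ 'n ^ 'n \<Rightarrow> ('n::finite \<times> 'n) set" where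
  "y_index Q = (SIGMA i:UNIV. nbrs Q i)"

definition milp_objective ::
    "real ^ 'n ^ 'n \<Rightarrow> real ^ 'n \<Rightarrow> (real ^ 'n::finite) \<times> ('n \<times> 'n \<Rightarrow> real) \<Rightarrow> real" where
  "milp_objective Q c = (\<lambda>(x, y).
     (\<Sum>i\<in>UNIV. \<Sum>j\<in>nbrs Q i. Q $ i $ j * y (i, j)) + (\<Sum>i\<in>UNIV. c $ i * x $ i))"

(* An MILP with this objective is given by its set F of feasible pairs (x, y). *)
definition valid_formulation ::
    "real ^ 'n ^ 'n \<Rightarrow> real ^ 'n \<Rightarrow> ((real ^ 'n::finite) \<times> ('n \<times> 'n \<Rightarrow> real)) set \<Rightarrow> bool" where
  "valid_formulation Q c F \<longleftrightarrow>
     (\<exists>v. has_optimal_value F (milp_objective Q c) v \<and>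
          has_optimal_value qubo_feasible (qubo_objective Q c) v) \<and>
     (\<forall>x y. is_arg_max (milp_objective Q c) (\<lambda>z. z \<in> F) (x, y) \<longrightarrow>
            is_arg_max (qubo_objective Q c) (\<lambda>x. x \<in> qubo_feasible) x)"

(* In the third constraint, y (j, i) is a variable of the program because Q is symmetric. *)
definition GW ::
    "real ^ 'n ^ 'n \<Rightarrow> ('n \<Rightarrow> 'n \<Rightarrow> real) \<Rightarrow> ((real ^ 'n::finite) \<times> ('n \<times> 'n \<Rightarrow> real)) set" where
  "GW Q \<alpha> = {(x, y). y \<in> extensional (y_index Q) \<and>
     (\<forall>i. (\<Sum>j\<in>nbrs Q i. \<alpha> i j * (x $ j - y (i, j))) \<le> (\<Sum>j\<in>nbrs Q i. \<alpha> i j) * (1 - x $ i)) \<and>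
     (\<forall>i. \<forall>j\<in>nbrs Q i. y (i, j) - x $ i \<le> 0) \<and>
     (\<forall>i. \<forall>j\<in>nbrs Q i. y (j, i) - x $ i \<le> 0) \<and>
     (\<forall>i. x $ i \<in> {0, 1}) \<and>
     (\<forall>i. \<forall>j\<in>nbrs Q i. y (i, j) \<ge> 0)}"

end

(* The constraints force y (i, j) = x_i x_j: if x_i = 0, then 0 \<le> y (i, j) \<le> x_i = 0; if x_i = 1,
   the aggregated constraint bounds a positively weighted sum of the terms x_j - y (i, j) \<ge> 0 by 0,
   so that all of them vanish. Hence GW is the graph of x \<mapsto> (x_i x_j) over the binary vectors,
   and the two objectives agree on it. *)
theory Submission
  imports Defs
begin

text \<open>The restriction to \<open>y_index Q\<close> makes this vector extensional, so that a
  feasible \<open>y\<close> can equal it as a function.\<close>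

definition products :: "real ^ 'n ^ 'n \<Rightarrow> real ^ 'n \<Rightarrow> ('n::finite \<times> 'n \<Rightarrow> real)" where
  "products Q x = (\<lambda>(i, j)\<in>y_index Q. x $ i * x $ j)"

lemma mem_y_index [simp]: "(i, j) \<in> y_index Q \<longleftrightarrow> j \<in> nbrs Q i"
  by (simp add: y_index_def)

text \<open>Makes (j, i) an index whenever (i, j) is one; at a pair that is no index,
  \<open>products Q x\<close> would be \<open>undefined\<close> and the third constraint could not
  be checked.\<close>

lemma nbrs_sym:
  assumes "transpose Q = Q"
  shows "i \<in> nbrs Q j \<longleftrightarrow> j \<in> nbrs Q i"
proof -
  have "Q $ i $ j = Q $ j $ i"
    using assms by (metis column_def column_transpose row_def vec_lambda_beta)
  then show ?thesis by (simp add: nbrs_def)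
qed

lemma milp_objective_products: "milp_objective Q c (x, products Q x) = qubo_objective Q c x"
  by (simp add: milp_objective_def qubo_objective_def products_def mult.assoc cong: sum.cong)

lemma products_in_GW:
  assumes sym: "transpose Q = Q"
    and pos: "\<And>i j. j \<in> nbrs Q i \<Longrightarrow> \<alpha> i j > 0"
    and x: "x \<in> qubo_feasible"
  shows "(x, products Q x) \<in> GW Q \<alpha>"
proof -
  have x01: "x $ i = 0 \<or> x $ i = 1" for i
    using x by (auto simp: qubo_feasible_def)
  have "(\<Sum>j\<in>nbrs Q i. \<alpha> i j * (x $ j - products Q x (i, j)))
      \<le> (\<Sum>j\<in>nbrs Q i. \<alpha> i j) * (1 - x $ i)" for i
    \<comment> \<open>The aggregated constraint holds term by term, because x_j - x_i x_j = x_j (1 -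
      x_i) \<le> 1 - x_i for binary x and the weights are positive.\<close>
    unfolding sum_distrib_right
  proof (rule sum_mono)
    fix j assume j: "j \<in> nbrs Q i"
    show "\<alpha> i j * (x $ j - products Q x (i, j)) \<le> \<alpha> i j * (1 - x $ i)"
      using pos[OF j] x01[of i] x01[of j] j by (auto simp: products_def)
  qed
  moreover have "products Q x (i, j) - x $ i \<le> 0 \<and> products Q x (j, i) - x $ i \<le> 0
      \<and> products Q x (i, j) \<ge> 0" if "j \<in> nbrs Q i" for i j
    using that nbrs_sym[OF sym, of i j] x01[of i] x01[of j] by (auto simp: products_def)
  ultimately show ?thesis
    using x01 by (auto simp: GW_def products_def)
qed

lemma GW_imp_products:
  assumes sym: "transpose Q = Q"
    and pos: "\<And>i j. j \<in> nbrs Q i \<Longrightarrow> \<alpha> i j > 0"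
    and xy: "(x, y) \<in> GW Q \<alpha>"
  shows "x \<in> qubo_feasible" and "y = products Q x"
proof -
  have x01: "x $ i = 0 \<or> x $ i = 1" for i
    using xy by (auto simp: GW_def)
  then show "x \<in> qubo_feasible"
    by (simp add: qubo_feasible_def)
  have agg: "(\<Sum>j\<in>nbrs Q i. \<alpha> i j * (x $ j - y (i, j))) \<le> (\<Sum>j\<in>nbrs Q i. \<alpha> i j) * (1 - x $ i)" for i
    using xy by (simp add: GW_def)
  \<comment> \<open>The bound by x_j is the third constraint with i and j exchanged, which is
    available by symmetry of the neighbour relation.\<close>
  have bounds: "0 \<le> y (i, j)" "y (i, j) \<le> x $ i" "y (i, j) \<le> x $ j" if "j \<in> nbrs Q i" for i j
    using xy that nbrs_sym[OF sym, of i j] by (auto simp: GW_def)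
  have y_eq: "y (i, j) = x $ i * x $ j" if j: "j \<in> nbrs Q i" for i j
  proof (cases "x $ i = 0")
    case True
    then show ?thesis using bounds[OF j] by simp
  next
    case False
    then have xi: "x $ i = 1" using x01 by blast
    have nonneg: "\<alpha> i k * (x $ k - y (i, k)) \<ge> 0" if "k \<in> nbrs Q i" for k
      using pos[OF that] bounds[OF that] by simp
    have "(\<Sum>k\<in>nbrs Q i. \<alpha> i k * (x $ k - y (i, k))) = 0"
      using agg[of i] xi by (intro antisym sum_nonneg nonneg) auto
    then have "\<alpha> i j * (x $ j - y (i, j)) = 0"
      using j nonneg by (simp add: sum_nonneg_eq_0_iff)
    then show ?thesis using pos[OF j] xi by simp
  qed
  \<comment> \<open>Both vectors are extensional on \<open>y_index Q\<close>, so agreement on the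
    indices gives equality.\<close>
  have "y \<in> extensional (y_index Q)"
    using xy by (simp add: GW_def)
  then show "y = products Q x"
    using y_eq by (auto simp: products_def intro!: extensionalityI[of _ "y_index Q"])
qed

lemma GW_eq_graph:
  assumes "transpose Q = Q"
    and "\<And>i j. j \<in> nbrs Q i \<Longrightarrow> \<alpha> i j > 0"
  shows "GW Q \<alpha> = (\<lambda>x. (x, products Q x)) ` qubo_feasible"
  using products_in_GW[OF assms] GW_imp_products[OF assms] by fast

text \<open>There are only finitely many binary vectors, and the zero vector is one of them, so any
  real function has a maximizer there.\<close>

lemma qubo_attains_max: "\<exists>x. is_arg_max f (\<lambda>x. x \<in> qubo_feasible) x"
  for f :: "real ^ 'n::finite \<Rightarrow> real"
proof -
  have "(qubo_feasible :: (real ^ 'n) set) \<subseteq> vec_lambda ` (UNIV \<rightarrow>\<^sub>E {0, 1 :: real})"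
  proof
    fix x :: "real ^ 'n" assume "x \<in> qubo_feasible"
    then have "vec_nth x \<in> UNIV \<rightarrow>\<^sub>E {0, 1}" by (simp add: qubo_feasible_def PiE_iff)
    then show "x \<in> vec_lambda ` (UNIV \<rightarrow>\<^sub>E {0, 1})" by (metis image_eqI vec_nth_inverse)
  qed
  then have "finite (qubo_feasible :: (real ^ 'n) set)"
    by (rule finite_subset) (intro finite_imageI finite_PiE; simp)
  moreover have "0 \<in> (qubo_feasible :: (real ^ 'n) set)"
    by (simp add: qubo_feasible_def)
  \<comment> \<open>A minimizer of -f over a finite nonempty set is a maximizer of f.\<close>
  ultimately show ?thesis
    using ex_is_arg_min_if_finite[of qubo_feasible "\<lambda>x. - f x"]
    by (auto simp: is_arg_min_def is_arg_max_def)
qed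

theorem theorem4:
  fixes Q :: "real ^ 'n ^ 'n::finite" and c :: "real ^ 'n" and \<alpha> :: "'n \<Rightarrow> 'n \<Rightarrow> real"
  assumes "transpose Q = Q"
    and "\<And>i. Q $ i $ i = 0"
    and "\<And>i j. j \<in> nbrs Q i \<Longrightarrow> \<alpha> i j > 0"
  shows "valid_formulation Q c (GW Q \<alpha>)"
proof -
  have graph: "GW Q \<alpha> = (\<lambda>x. (x, products Q x)) ` qubo_feasible"
    using assms(1,3) by (rule GW_eq_graph)
  \<comment> \<open>Each binary x has exactly one feasible partner y, and the objectives agree on
    that pair, so maximizers correspond one to one.\<close>
  have arg_max_iff: "is_arg_max (milp_objective Q c) (\<lambda>z. z \<in> GW Q \<alpha>) (x, y)
      \<longleftrightarrow> is_arg_max (qubo_objective Q c) (\<lambda>x. x \<in> qubo_feasible) x \<and> y = products Q x" for x y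
    by (auto simp: is_arg_max_def graph milp_objective_products)
  \<comment> \<open>The value of this maximizer serves as the common optimal value of both
    problems.\<close>
  obtain x where "is_arg_max (qubo_objective Q c) (\<lambda>x. x \<in> qubo_feasible) x"
    using qubo_attains_max by blast
  then show ?thesis
    unfolding valid_formulation_def has_optimal_value_def
    using arg_max_iff milp_objective_products by blast
qed

end
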